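(* Let $\varepsilon\in(0,1/2]$ and $t\in\mathbb{N}$. For every $0<\varepsilon'<\varepsilon$ there exists a constant $K=K(\varepsilon,\varepsilon')$ (depending only on $\varepsilon$ and $\varepsilon'$) such that every $\varepsilon$-balanced bicolored graph $G$ with sufficiently many vertices and with \[ e(G)\geq \left(1-\frac{1}{K\cdot R(\varepsilon',t)}\right)\binom{v(G)}{2} \] edges contains an unavoidable $t$-graph.
   Context: A bicolored graph is a simple graph whose edges are each colored red or blue. A bicolored graph $G$ is $\varepsilon$-balanced if each of the two color classes contains at least $\varepsilon\cdot e(G)$ edges. A bicolored graph $H$ is contained in $G$ (or $G$ contains a copy of $H$) if there is an injective map $V(H)\to V(G)$ sending every edge of $H$ to an edge of $G$ of the same color. An unavoidable $t$-graph is a bicolored complete graph $K_{2t}$ in which one of the two color classes is either a clique on $t$ vertices (Type 1) or the union of two vertex-disjoint cliques on $t$ vertices each (Type 2); all remaining edges have the other color. For $\varepsilon\in(0,1/2]$ and $t\in\mathbb{N}$, $R(\varepsilon,t)$ is the smallest integer such that for every $n\ge R(\varepsilon,t)$, every $\varepsilon$-balanced bicolored $K_n$ contains an unavoidable $t$-graph. *)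

theory Defs
  imports Complex_Main "HOL-Library.Ramsey"
begin

datatype colour = Red | Blue

text \<open>The colour map is total for convenience; only its values on edges matter.\<close>

record 'a bigraph =
  verts :: "'a set"
  edges :: "'a set set"
  colour_of :: "'a set \<Rightarrow> colour"

text \<open>\<^term>\<open>nsets A 2\<close> is the set of all 2-element subsets of \<open>A\<close>, i.e. the edge set of the
  clique on \<open>A\<close>. All graphs are finite.\<close>

definition bicolored_graph :: "'a bigraph \<Rightarrow> bool" where
  "bicolored_graph G \<longleftrightarrow> finite (verts G) \<and> edges G \<subseteq> nsets (verts G) 2"

definition bicolored_complete :: "nat \<Rightarrow> 'a bigraph \<Rightarrow> bool" where
  "bicolored_complete n G \<longleftrightarrow>
     bicolored_graph G \<and> card (verts G) = n \<and> edges G = nsets (verts G) 2"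

definition colour_class :: "'a bigraph \<Rightarrow> colour \<Rightarrow> 'a set set" where
  "colour_class G c = {e \<in> edges G. colour_of G e = c}"

definition balanced :: "real \<Rightarrow> 'a bigraph \<Rightarrow> bool" where
  "balanced \<epsilon> G \<longleftrightarrow> (\<forall>c. real (card (colour_class G c)) \<ge> \<epsilon> * real (card (edges G)))"

definition contained_in :: "'b bigraph \<Rightarrow> 'a bigraph \<Rightarrow> bool" where
  "contained_in H G \<longleftrightarrow>
     (\<exists>f. inj_on f (verts H) \<and> f ` verts H \<subseteq> verts G \<and>
          (\<forall>e \<in> edges H. f ` e \<in> edges G \<and> colour_of G (f ` e) = colour_of H e))"

definition type1 :: "nat \<Rightarrow> 'a bigraph \<Rightarrow> bool" where
  "type1 t H \<longleftrightarrow> bicolored_complete (2 * t) H \<and>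
     (\<exists>c A. A \<subseteq> verts H \<and> card A = t \<and> colour_class H c = nsets A 2)"

definition type2 :: "nat \<Rightarrow> 'a bigraph \<Rightarrow> bool" where
  "type2 t H \<longleftrightarrow> bicolored_complete (2 * t) H \<and>
     (\<exists>c A B. A \<subseteq> verts H \<and> B \<subseteq> verts H \<and> A \<inter> B = {} \<and> card A = t \<and> card B = t \<and>
              colour_class H c = nsets A 2 \<union> nsets B 2)"

definition unavoidable :: "nat \<Rightarrow> 'a bigraph \<Rightarrow> bool" where
  "unavoidable t H \<longleftrightarrow> type1 t H \<or> type2 t H"

text \<open>Containment is invariant under isomorphism of \<open>H\<close>, so it suffices to let the finite
  graph \<open>H\<close> have natural numbers as vertices, whatever the vertex type of \<open>G\<close>.\<close>

definition contains_unavoidable :: "nat \<Rightarrow> 'a bigraph \<Rightarrow> bool" where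
  "contains_unavoidable t G \<longleftrightarrow> (\<exists>H :: nat bigraph. unavoidable t H \<and> contained_in H G)"

text \<open>For \<open>t \<ge> 1\<close> no number below \<open>2\<close> qualifies (the one-vertex graph is balanced but has no
  edge), so the least integer and the least natural number with the property agree. As above,
  natural numbers as vertices cover every finite graph up to isomorphism.\<close>

definition R :: "real \<Rightarrow> nat \<Rightarrow> nat" where
  "R \<epsilon> t = (LEAST r. \<forall>n\<ge>r. \<forall>G :: nat bigraph.
      bicolored_complete n G \<and> balanced \<epsilon> G \<longrightarrow> contains_unavoidable t G)"

end

theory Submission
  imports Defs
begin

text \<open>Put \<open>r = R \<epsilon>' t\<close>. Delete vertices of \<open>G\<close> one at a time down to a set of \<open>m = C r\<close> vertices, where
  \<open>C\<close> depends only on \<open>\<epsilon> - \<epsilon>'\<close>. The densities of red, blue and missing pairs are martingales under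
  random deletion, and the increments from \<open>s\<close> vertices are at most \<open>2 / (s - 2)\<close>. So a potential
  made of the squared deviations of the two colour densities and a multiple of the density of
  missing pairs increases by only \<open>O(1 / m)\<close> in total for a suitable choice of deletions.
  The \<open>m\<close>-set reached has nearly the original colour densities and lacks at most \<open>\<delta> m\<close> pairs;
  deleting one end of each leaves an \<open>\<epsilon>'\<close>-balanced clique on at least \<open>r\<close> vertices.

  It remains that \<open>R \<epsilon>' t\<close> is not the junk value of \<open>LEAST\<close>. In a large balanced complete
  graph, linearly many vertices have large degree in both colours, and double counting gives large sets
  \<open>T\<close>, \<open>P\<close>, \<open>Q\<close> with all \<open>T\<close>-\<open>P\<close> edges red and all \<open>T\<close>-\<open>Q\<close> edges blue. By Ramsey, \<open>T\<close>, \<open>P\<close>, \<open>Q\<close> contain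
  monochromatic \<open>t\<close>-cliques; the one in \<open>T\<close> together with the one joined to it in the opposite
  colour is an unavoidable \<open>t\<close>-graph.\<close>

section \<open>Edge densities of vertex subsets\<close>

text \<open>The family \<open>F\<close> is left arbitrary, so that the two colour classes and the
  set of missing pairs are treated alike.\<close>

definition inside :: "'a set set \<Rightarrow> 'a set \<Rightarrow> 'a set set" where
  "inside F S = {e \<in> F. e \<subseteq> S}"

definition incident :: "'a set set \<Rightarrow> 'a set \<Rightarrow> 'a \<Rightarrow> 'a set set" where
  "incident F S v = {e \<in> inside F S. v \<in> e}"

text \<open>With fewer than two vertices the quotient is 0 by convention; the deletion lemmas ask
  for \<open>card S \<ge> 3\<close> so that \<open>S - {v}\<close> still contains a pair.\<close>

definition density :: "'a set set \<Rightarrow> 'a set \<Rightarrow> real" where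
  "density F S = real (card (inside F S)) / real (card S choose 2)"

lemma real_choose_two: "real (n choose 2) = real n * (real n - 1) / 2"
  by (induction n) (auto simp: numeral_2_eq_2 field_simps)

lemma finite_inside: "finite S \<Longrightarrow> finite (inside F S)"
  by (rule finite_subset[of _ "Pow S"]) (auto simp: inside_def)

lemma card_incident_le:
  assumes "finite S" "\<forall>e\<in>F. card e = 2"
  shows "card (incident F S v) \<le> card S - 1"
proof (cases "v \<in> S")
  case True
  have "incident F S v \<subseteq> (\<lambda>u. {v, u}) ` (S - {v})"
  proof
    fix e assume e: "e \<in> incident F S v"
    then have "card e = 2" "e \<subseteq> S" "v \<in> e"
      using assms by (auto simp: incident_def inside_def)
    then show "e \<in> (\<lambda>u. {v, u}) ` (S - {v})"
      by (auto simp: card_2_iff)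
  qed
  then have "card (incident F S v) \<le> card (S - {v})"
    using assms(1) by (meson card_image_le card_mono finite_Diff finite_imageI le_trans)
  then show ?thesis
    using True by simp
next
  case False
  then have "incident F S v = {}"
    by (auto simp: incident_def inside_def)
  then show ?thesis by simp
qed

lemma handshake:
  assumes "finite S" "\<forall>e\<in>F. card e = 2"
  shows "(\<Sum>v\<in>S. card (incident F S v)) = 2 * card (inside F S)"
  unfolding incident_def
proof (rule sum_multicount[OF assms(1) finite_inside[OF assms(1)]], intro ballI)
  fix e assume "e \<in> inside F S"
  then have "{v \<in> S. v \<in> e} = e" "card e = 2"
    using assms(2) by (auto simp: inside_def)
  then show "card {v \<in> S. v \<in> e} = 2" by simp
qed

lemma card_inside_remove:
  assumes "finite S"
  shows "real (card (inside F (S - {v}))) = real (card (inside F S)) - real (card (incident F S v))"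
proof -
  have "inside F (S - {v}) = inside F S - incident F S v"
    by (auto simp: inside_def incident_def)
  moreover have "incident F S v \<subseteq> inside F S"
    by (auto simp: incident_def)
  ultimately show ?thesis
    using finite_inside[OF assms, of F]
    by (simp add: card_Diff_subset card_mono finite_subset of_nat_diff)
qed

lemma card_inside_le:
  assumes "finite S" "\<forall>e\<in>F. card e = 2"
  shows "card (inside F S) \<le> card S choose 2"
proof -
  have "inside F S \<subseteq> {e. e \<subseteq> S \<and> card e = 2}"
    using assms(2) by (auto simp: inside_def)
  then have "card (inside F S) \<le> card {e. e \<subseteq> S \<and> card e = 2}"
    using assms(1) by (intro card_mono) auto
  then show ?thesis using n_subsets[OF assms(1)] by simp
qed

text \<open>Over the common denominator, the numerator compares the degree \<open>d\<close> of
  \<open>v\<close> with the average degree \<open>2 * x / s\<close>.\<close>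

lemma density_remove_diff:
  assumes "finite S" "v \<in> S" "card S \<ge> 3"
  shows "density F (S - {v}) - density F S =
    2 * (2 * real (card (inside F S)) - real (card S) * real (card (incident F S v)))
      / (real (card S) * (real (card S) - 1) * (real (card S) - 2))"
proof -
  define s x d where "s = real (card S)" and "x = real (card (inside F S))"
    and "d = real (card (incident F S v))"
  have s: "s \<ge> 3" using assms(3) by (simp add: s_def)
  have c: "real (card (S - {v})) = s - 1"
    using assms by (simp add: s_def of_nat_diff)
  have 1: "density F (S - {v}) = (x - d) / ((s - 1) * (s - 2) / 2)"
    unfolding density_def real_choose_two c card_inside_remove[OF assms(1)] x_def d_def by simp
  have 2: "density F S = x / (s * (s - 1) / 2)"
    unfolding density_def real_choose_two x_def s_def by simp
  have "s \<noteq> 0" "s - 1 \<noteq> 0" "s - 2 \<noteq> 0" using s by auto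
  then show ?thesis
    unfolding 1 2 s_def[symmetric] x_def[symmetric] d_def[symmetric]
    by (simp add: divide_simps) (simp add: algebra_simps)
qed

text \<open>The martingale property: by \<open>handshake\<close> the deviations of the degrees from
  their average cancel.\<close>

lemma sum_density_remove_diff:
  assumes "finite S" "card S \<ge> 3" "\<forall>e\<in>F. card e = 2"
  shows "(\<Sum>v\<in>S. density F (S - {v}) - density F S) = 0"
proof -
  have h: "(\<Sum>v\<in>S. real (card (incident F S v))) = 2 * real (card (inside F S))"
    using handshake[OF assms(1,3)] by (metis of_nat_mult of_nat_numeral of_nat_sum)
  have "(\<Sum>v\<in>S. density F (S - {v}) - density F S) = (\<Sum>v\<in>S.
    2 * (2 * real (card (inside F S)) - real (card S) * real (card (incident F S v)))
      / (real (card S) * (real (card S) - 1) * (real (card S) - 2)))"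
    using assms by (intro sum.cong) (auto simp: density_remove_diff)
  also have "\<dots> = 2 * (\<Sum>v\<in>S. 2 * real (card (inside F S)) - real (card S) * real (card (incident F S v)))
      / (real (card S) * (real (card S) - 1) * (real (card S) - 2))"
    by (simp add: sum_divide_distrib sum_distrib_left)
  also have "(\<Sum>v\<in>S. 2 * real (card (inside F S)) - real (card S) * real (card (incident F S v))) = 0"
    by (simp add: sum_subtractf sum_distrib_left[symmetric] h)
  finally show ?thesis by simp
qed

text \<open>Both \<open>2 * x\<close> and \<open>s * d\<close> lie between 0 and
  \<open>s * (s - 1)\<close>, so they differ by at most that much.\<close>

lemma abs_density_remove_diff_le:
  assumes "finite S" "v \<in> S" "card S \<ge> 3" "\<forall>e\<in>F. card e = 2"
  shows "\<bar>density F (S - {v}) - density F S\<bar> \<le> 2 / (real (card S) - 2)"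
proof -
  define s x d where "s = real (card S)" and "x = real (card (inside F S))"
    and "d = real (card (incident F S v))"
  have s: "s \<ge> 3" using assms(3) by (simp add: s_def)
  have x: "0 \<le> 2 * x" "2 * x \<le> s * (s - 1)"
    using card_inside_le[OF assms(1,4)] real_choose_two[of "card S"]
    by (auto simp: x_def s_def simp flip: of_nat_le_iff[where 'a = real])
  have "d \<le> s - 1"
    using card_incident_le[OF assms(1,4), of v] assms(3) by (simp add: d_def s_def)
  then have d: "0 \<le> s * d" "s * d \<le> s * (s - 1)"
    using s by (auto simp: d_def)
  have "\<bar>2 * x - s * d\<bar> \<le> s * (s - 1)" using x d by linarith
  moreover have pos: "0 < s * (s - 1) * (s - 2)" using s by simp
  ultimately have "\<bar>2 * (2 * x - s * d) / (s * (s - 1) * (s - 2))\<bar>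
      \<le> 2 * (s * (s - 1)) / (s * (s - 1) * (s - 2))"
    unfolding abs_divide abs_of_pos[OF pos] using pos
    by (intro divide_right_mono) (simp_all add: abs_mult)
  also have "\<dots> = 2 / (s - 2)" using s by (simp add: divide_simps)
  finally show ?thesis
    unfolding density_remove_diff[OF assms(1-3)] s_def x_def d_def .
qed

section \<open>A potential under deletion of vertices\<close>

text \<open>Colour densities must be controlled from both sides, hence the squares. Missing pairs
  need only an upper bound, and a linear term does not change on average.\<close>

definition deviation ::
  "'i set \<Rightarrow> ('i \<Rightarrow> 'a set set) \<Rightarrow> ('i \<Rightarrow> real) \<Rightarrow> real \<Rightarrow> 'a set set \<Rightarrow> 'a set \<Rightarrow> real" where
  "deviation I F \<rho> l M S = (\<Sum>i\<in>I. (density (F i) S - \<rho> i)\<^sup>2) + l * density M S"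

text \<open>Deleting a uniformly random vertex leaves each density unchanged on average, so only the
  squared increments contribute.\<close>

lemma ex_remove_deviation_le:
  assumes S: "finite S" "card S \<ge> 3"
    and F: "\<And>i. i \<in> I \<Longrightarrow> \<forall>e\<in>F i. card e = 2" and M: "\<forall>e\<in>M. card e = 2"
  shows "\<exists>v\<in>S. deviation I F \<rho> l M (S - {v})
    \<le> deviation I F \<rho> l M S + 4 * real (card I) / (real (card S) - 2)\<^sup>2"
proof (rule ccontr)
  define s where "s = real (card S)"
  let ?B = "4 / (s - 2)\<^sup>2"
  assume "\<not> ?thesis"
  then have lt: "deviation I F \<rho> l M S + real (card I) * ?B < deviation I F \<rho> l M (S - {v})"
    if "v \<in> S" for v using that by (force simp: s_def mult.commute)
  have "S \<noteq> {}" using S by auto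
  \<comment> \<open>Averaging: summed over \<open>v\<close>, the supposed failure of every deletion
    makes this total strictly smaller than itself.\<close>
  have "s * (deviation I F \<rho> l M S + real (card I) * ?B)
      = (\<Sum>v\<in>S. deviation I F \<rho> l M S + real (card I) * ?B)"
    by (simp add: s_def)
  also have "\<dots> < (\<Sum>v\<in>S. deviation I F \<rho> l M (S - {v}))"
    by (rule sum_strict_mono) (use S \<open>S \<noteq> {}\<close> lt in auto)
  also have "\<dots> = (\<Sum>i\<in>I. \<Sum>v\<in>S. (density (F i) (S - {v}) - \<rho> i)\<^sup>2)
      + l * (\<Sum>v\<in>S. density M (S - {v}))"
    unfolding deviation_def sum.distrib sum_distrib_left by (simp add: sum.swap[of _ S I])
  also have "(\<Sum>v\<in>S. density M (S - {v})) = s * density M S"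
    using sum_density_remove_diff[OF S M] by (simp add: sum_subtractf s_def)
  also have "(\<Sum>i\<in>I. \<Sum>v\<in>S. (density (F i) (S - {v}) - \<rho> i)\<^sup>2)
      \<le> (\<Sum>i\<in>I. s * (density (F i) S - \<rho> i)\<^sup>2 + s * ?B)"
  proof (rule sum_mono)
    fix i assume i: "i \<in> I"
    let ?r = "density (F i) S" and ?q = "\<lambda>v. density (F i) (S - {v})"
    have "(\<Sum>v\<in>S. (?q v - \<rho> i)\<^sup>2)
        = (\<Sum>v\<in>S. (?q v - ?r)\<^sup>2 + 2 * (?r - \<rho> i) * (?q v - ?r) + (?r - \<rho> i)\<^sup>2)"
      by (intro sum.cong refl) (simp add: power2_eq_square algebra_simps)
    also have "\<dots> = (\<Sum>v\<in>S. (?q v - ?r)\<^sup>2) + 2 * (?r - \<rho> i) * (\<Sum>v\<in>S. ?q v - ?r)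
        + s * (?r - \<rho> i)\<^sup>2"
      by (simp only: sum.distrib sum_distrib_left sum_constant s_def)
    also have "(\<Sum>v\<in>S. ?q v - ?r) = 0"
      using sum_density_remove_diff[OF S F[OF i]] .
    also have "(\<Sum>v\<in>S. (?q v - ?r)\<^sup>2) \<le> (\<Sum>v\<in>S. ?B)"
    proof (rule sum_mono)
      fix v assume "v \<in> S"
      then have "\<bar>?q v - ?r\<bar> \<le> 2 / (s - 2)"
        unfolding s_def by (intro abs_density_remove_diff_le S F i)
      then have "(?q v - ?r)\<^sup>2 \<le> (2 / (s - 2))\<^sup>2"
        by (metis abs_ge_zero power2_abs power_mono)
      then show "(?q v - ?r)\<^sup>2 \<le> ?B" by (simp add: power_divide)
    qed
    finally show "(\<Sum>v\<in>S. (?q v - \<rho> i)\<^sup>2) \<le> s * (?r - \<rho> i)\<^sup>2 + s * ?B"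
      by (simp add: s_def)
  qed
  also have "(\<Sum>i\<in>I. s * (density (F i) S - \<rho> i)\<^sup>2 + s * ?B) + l * (s * density M S)
      = s * (deviation I F \<rho> l M S + real (card I) * ?B)"
    unfolding deviation_def by (simp add: sum.distrib sum_distrib_left[symmetric] algebra_simps)
  finally show False by simp
qed

text \<open>A deletion from \<open>s\<close> vertices costs \<open>4 * card I / (s - 2)^2\<close>.
  The sum of these costs over \<open>s > k\<close> is bounded in terms of \<open>k\<close> and
  \<open>card I\<close>, however large \<open>V\<close> is.\<close>

lemma ex_subset_deviation_le:
  assumes V: "finite V" and k: "3 \<le> k" "k \<le> card V"
    and F: "\<And>i. i \<in> I \<Longrightarrow> \<forall>e\<in>F i. card e = 2" and M: "\<forall>e\<in>M. card e = 2"
  shows "\<exists>S\<subseteq>V. card S = k \<and> deviation I F \<rho> l M S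
    \<le> deviation I F \<rho> l M V + 4 * real (card I) / (real k - 2)"
  using k(2,1)
proof (induction k rule: inc_induct)
  case base
  then show ?case by (intro exI[of _ V]) auto
next
  case (step k)
  then obtain S where S: "S \<subseteq> V" "card S = Suc k"
    "deviation I F \<rho> l M S \<le> deviation I F \<rho> l M V + 4 * real (card I) / (real (Suc k) - 2)"
    by auto
  have fS: "finite S" using S V finite_subset by blast
  obtain v where v: "v \<in> S" "deviation I F \<rho> l M (S - {v})
    \<le> deviation I F \<rho> l M S + 4 * real (card I) / (real (card S) - 2)\<^sup>2"
    using ex_remove_deviation_le[of S I F M \<rho> l] fS F M S step.prems by auto
  \<comment> \<open>The first term is the bound for \<open>Suc k\<close> vertices, the second the
    cost of the next deletion; it rests on \<open>x * (x - 2) \<le> (x - 1)^2\<close>.\<close>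
  have x: "1 / (x - 1) + 1 / (x - 1)\<^sup>2 \<le> 1 / (x - 2)" if "x \<ge> 3" for x :: real
  proof -
    have "1 / (x - 1) + 1 / (x - 1)\<^sup>2 = x / (x - 1)\<^sup>2"
      using that by (simp add: divide_simps power2_eq_square)
    also have "\<dots> \<le> 1 / (x - 2)"
      using that zero_le_power2[of "x - 1"]
      by (simp add: divide_simps power2_eq_square algebra_simps)
    finally show ?thesis .
  qed
  have "deviation I F \<rho> l M (S - {v}) \<le> deviation I F \<rho> l M V
      + 4 * real (card I) * (1 / (real k - 1) + 1 / (real k - 1)\<^sup>2)"
    using v(2) S(2,3) by (simp add: algebra_simps)
  also have "\<dots> \<le> deviation I F \<rho> l M V + 4 * real (card I) * (1 / (real k - 2))"
    using step.prems by (intro add_left_mono mult_left_mono x) auto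
  finally show ?case
    using S v by (intro exI[of _ "S - {v}"]) auto
qed

section \<open>Clearing the missing pairs\<close>

text \<open>Choose one end of each pair of \<open>M\<close> inside \<open>S\<close>; the chosen ends
  meet all these pairs.\<close>

lemma ex_removal_set:
  assumes "finite S" "\<forall>e\<in>M. card e = 2"
  shows "\<exists>D\<subseteq>S. card D \<le> card (inside M S) \<and> inside M (S - D) = {}"
proof -
  have "\<exists>x. x \<in> e" if "e \<in> inside M S" for e
    using that assms(2) by (force simp: inside_def card_2_iff)
  then obtain f where f: "f e \<in> e" if "e \<in> inside M S" for e by metis
  have "f ` inside M S \<subseteq> S" using f by (auto simp: inside_def)
  moreover have "card (f ` inside M S) \<le> card (inside M S)"
    by (intro card_image_le finite_inside assms(1))
  moreover have "inside M (S - f ` inside M S) = {}"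
  proof (rule ccontr)
    assume "inside M (S - f ` inside M S) \<noteq> {}"
    then obtain e where "e \<in> M" "e \<subseteq> S - f ` inside M S" by (auto simp: inside_def)
    moreover from this have "e \<in> inside M S" by (auto simp: inside_def)
    ultimately show False using f[of e] by blast
  qed
  ultimately show ?thesis by blast
qed

text \<open>Delete \<open>D\<close> one vertex at a time; by \<open>card_incident_le\<close> each
  takes at most \<open>card S - 1\<close> edges with it.\<close>

lemma card_inside_Diff_ge:
  assumes "finite S" "\<forall>e\<in>F. card e = 2" "finite D"
  shows "card (inside F S) \<le> card (inside F (S - D)) + card D * (card S - 1)"
  using assms(3)
proof (induction D)
  case empty
  then show ?case by simp
next
  case (insert d D)
  have eq: "S - insert d D = S - D - {d}" by blast
  have "card (incident F (S - D) d) \<le> card (S - D) - 1"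
    using assms by (intro card_incident_le) auto
  also have "\<dots> \<le> card S - 1" by (intro diff_le_mono card_mono) (use assms in auto)
  finally have "card (inside F (S - D)) \<le> card (inside F (S - insert d D)) + (card S - 1)"
    using card_inside_remove[of "S - D" F d] assms(1) unfolding eq by simp
  then show ?case using insert by simp
qed

section \<open>Containment\<close>

text \<open>Moves a clique to another vertex type, in particular to the natural numbers, over which
  \<open>R\<close> and \<open>contains_unavoidable\<close> are stated. All pairs become edges, so it
  is a faithful copy only if the image of \<open>V\<close> is a clique of \<open>G\<close>.\<close>

definition pullback :: "('b \<Rightarrow> 'a) \<Rightarrow> 'b set \<Rightarrow> 'a bigraph \<Rightarrow> 'b bigraph" where
  "pullback f V G = \<lparr>verts = V, edges = nsets V 2, colour_of = (\<lambda>e. colour_of G (f ` e))\<rparr>"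

lemma bicolored_complete_pullback:
  "finite V \<Longrightarrow> bicolored_complete (card V) (pullback f V G)"
  by (simp add: pullback_def bicolored_complete_def bicolored_graph_def)

lemma image_nsets_2: "inj_on f V \<Longrightarrow> e \<in> nsets V 2 \<Longrightarrow> f ` e \<in> nsets (f ` V) 2"
  by (auto simp: nsets_def card_image inj_on_subset)

lemma contained_in_pullback:
  assumes "inj_on f V" "f ` V \<subseteq> verts G" "nsets (f ` V) 2 \<subseteq> edges G"
  shows "contained_in (pullback f V G) G"
  unfolding contained_in_def pullback_def using assms image_nsets_2[OF assms(1)]
  by (intro exI[of _ f]) auto

lemma contained_in_trans:
  assumes "contained_in F H" "contained_in H G" "bicolored_graph F"
  shows "contained_in F G"
proof -
  obtain f where f: "inj_on f (verts F)" "f ` verts F \<subseteq> verts H"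
    "\<And>e. e \<in> edges F \<Longrightarrow> f ` e \<in> edges H \<and> colour_of H (f ` e) = colour_of F e"
    using assms(1) by (auto simp: contained_in_def)
  obtain g where g: "inj_on g (verts H)" "g ` verts H \<subseteq> verts G"
    "\<And>e. e \<in> edges H \<Longrightarrow> g ` e \<in> edges G \<and> colour_of G (g ` e) = colour_of H e"
    using assms(2) by (auto simp: contained_in_def)
  have "inj_on (g \<circ> f) (verts F)"
    using f g by (intro comp_inj_on) (blast intro: inj_on_subset)+
  moreover have "(g \<circ> f) ` verts F \<subseteq> verts G"
    using f(2) g(2) by auto
  moreover have "(g \<circ> f) ` e \<in> edges G \<and> colour_of G ((g \<circ> f) ` e) = colour_of F e"
    if "e \<in> edges F" for e
    using f(3)[OF that] g(3) unfolding image_comp[symmetric] by simp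
  ultimately show ?thesis
    unfolding contained_in_def by blast
qed

lemma bicolored_graph_unavoidable: "unavoidable t H \<Longrightarrow> bicolored_graph H"
  by (auto simp: unavoidable_def type1_def type2_def bicolored_complete_def)

lemma contains_unavoidable_trans:
  assumes "contains_unavoidable t H" "contained_in H G"
  shows "contains_unavoidable t G"
  using assms contained_in_trans bicolored_graph_unavoidable
  unfolding contains_unavoidable_def by blast

text \<open>If \<open>d = c\<close>, the colour class of \<open>c\<close> consists of both cliques
  (Type 2); otherwise it is the clique on \<open>A\<close> alone (Type 1).\<close>

lemma contains_unavoidableI:
  assumes "finite A" "finite B" "A \<inter> B = {}" "card A = t" "card B = t"
    and G: "A \<union> B \<subseteq> verts G" "nsets (A \<union> B) 2 \<subseteq> edges G"
    and c: "\<And>e. e \<in> nsets A 2 \<Longrightarrow> colour_of G e = c"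
      "\<And>e. e \<in> nsets B 2 \<Longrightarrow> colour_of G e = d"
      "\<And>a b. a \<in> A \<Longrightarrow> b \<in> B \<Longrightarrow> colour_of G {a, b} = c'" "c \<noteq> c'"
  shows "contains_unavoidable t G"
proof -
  have "card (A \<union> B) = 2 * t" using assms(1-5) by (simp add: card_Un_disjoint)
  then obtain f where f: "bij_betw f {..<2 * t} (A \<union> B)"
    using ex_bij_betw_nat_finite[of "A \<union> B"] assms(1,2)
    by (metis atLeast0LessThan finite_UnI)
  define V and H and pre where "V = {..<2 * t}" and "H = pullback f V G"
    and "pre = (\<lambda>X. {i \<in> V. f i \<in> X})"
  have inj: "inj_on f V" and im: "f ` V = A \<union> B"
    using f by (auto simp: V_def bij_betw_def)
  have card_pre: "card (pre X) = card X" if "X \<subseteq> A \<union> B" for X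
  proof -
    have "f ` pre X = f ` V \<inter> X" by (auto simp: pre_def)
    then have "f ` pre X = X" using that im by auto
    moreover have "inj_on f (pre X)" by (rule inj_on_subset[OF inj]) (auto simp: pre_def)
    ultimately show ?thesis by (metis card_image)
  qed
  have preAB: "pre A \<inter> pre B = {}" "pre A \<union> pre B = V"
    using assms(3) im by (auto simp: pre_def)
  have colour: "colour_of H e = colour_of G (f ` e)" for e
    by (simp add: H_def pullback_def)
  have colour_pre: "f ` e \<in> nsets X 2" if "e \<in> nsets (pre X) 2" for e X
  proof -
    have "f ` e \<in> nsets (f ` pre X) 2"
      using that inj by (intro image_nsets_2) (auto simp: pre_def inj_on_def)
    then show ?thesis
      using nsets_mono[of "f ` pre X" X 2] by (auto simp: pre_def)
  qed
  have colour_A: "colour_of H e = c" if "e \<in> nsets (pre A) 2" for e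
    using c(1) colour_pre[OF that] by (simp add: colour)
  have colour_B: "colour_of H e = d" if "e \<in> nsets (pre B) 2" for e
    using c(2) colour_pre[OF that] by (simp add: colour)
  have colour_AB: "colour_of H e = c'"
    if e: "e \<in> nsets V 2" "e \<notin> nsets (pre A) 2" "e \<notin> nsets (pre B) 2" for e
  proof -
    obtain x y where xy: "e = {x, y}" "x \<in> V" "y \<in> V" "x \<noteq> y"
      using e(1) by (elim nsets2_E)
    then have "x \<in> pre A \<and> y \<in> pre B \<or> x \<in> pre B \<and> y \<in> pre A"
      using e preAB by simp blast
    then have "f x \<in> A \<and> f y \<in> B \<or> f y \<in> A \<and> f x \<in> B"
      by (auto simp: pre_def)
    then have "colour_of G {f x, f y} = c'"
      using c(3) by (metis insert_commute)
    then show ?thesis by (simp add: colour xy(1))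
  qed
  have compl: "bicolored_complete (2 * t) H"
    using bicolored_complete_pullback[of V f G] by (simp add: H_def V_def)
  have H: "verts H = V" "edges H = nsets V 2" by (simp_all add: H_def pullback_def)
  have sub: "pre A \<subseteq> V" "pre B \<subseteq> V" by (auto simp: pre_def)
  have card: "card (pre A) = t" "card (pre B) = t"
    using card_pre[of A] card_pre[of B] assms(4,5) by auto
  have "unavoidable t H"
  proof (cases "d = c")
    case True
    have "colour_class H c = nsets (pre A) 2 \<union> nsets (pre B) 2"
    proof (intro equalityI subsetI)
      fix e assume "e \<in> colour_class H c"
      then show "e \<in> nsets (pre A) 2 \<union> nsets (pre B) 2"
        using colour_AB[of e] c(4) by (auto simp: colour_class_def H)
    next
      fix e assume "e \<in> nsets (pre A) 2 \<union> nsets (pre B) 2"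
      then show "e \<in> colour_class H c"
        using colour_A[of e] colour_B[of e] True nsets_mono[OF sub(1), of 2] nsets_mono[OF sub(2), of 2]
        by (auto simp: colour_class_def H)
    qed
    then have "type2 t H" unfolding type2_def H(1)
      by (intro conjI compl exI[of _ c] exI[of _ "pre A"] exI[of _ "pre B"] card sub preAB(1))
    then show ?thesis by (simp add: unavoidable_def)
  next
    case False
    have "colour_class H c = nsets (pre A) 2"
    proof (intro equalityI subsetI)
      fix e assume "e \<in> colour_class H c"
      then show "e \<in> nsets (pre A) 2"
        using colour_AB[of e] colour_B[of e] c(4) False by (auto simp: colour_class_def H)
    next
      fix e assume "e \<in> nsets (pre A) 2"
      then show "e \<in> colour_class H c"
        using colour_A[of e] nsets_mono[OF sub(1), of 2] by (auto simp: colour_class_def H)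
    qed
    then have "type1 t H" unfolding type1_def H(1)
      by (intro conjI compl exI[of _ c] exI[of _ "pre A"] card(1) sub(1))
    then show ?thesis by (simp add: unavoidable_def)
  qed
  moreover have "contained_in H G"
    unfolding H_def using contained_in_pullback[OF inj] G unfolding im by blast
  ultimately show ?thesis unfolding contains_unavoidable_def by blast
qed

section \<open>Complete graphs\<close>

text \<open>Ramsey's theorem for the graph of red pairs: its cliques are red and its independent
  sets blue.\<close>

lemma ex_monochromatic_subset:
  "\<exists>r. \<forall>V \<chi>. finite (V :: 'a set) \<and> r \<le> card V \<longrightarrow>
    (\<exists>A\<subseteq>V. \<exists>c :: colour. card A = t \<and> (\<forall>e\<in>nsets A 2. \<chi> e = c))"
proof -
  obtain r where r: "\<And>V E. finite (V :: 'a set) \<and> r \<le> card V \<Longrightarrow>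
      \<exists>A\<subseteq>V. card A = t \<and> clique A E \<or> card A = t \<and> indep A E"
    using ramsey2[where 'a = 'a and m = t and n = t] by blast
  show ?thesis
  proof (intro exI[of _ r] allI impI)
    fix V :: "'a set" and \<chi> :: "'a set \<Rightarrow> colour"
    assume "finite V \<and> r \<le> card V"
    from r[OF this, of "{e. \<chi> e = Red}"]
    obtain A where A: "A \<subseteq> V" "card A = t" "clique A {e. \<chi> e = Red} \<or> indep A {e. \<chi> e = Red}"
      by blast
    have "\<exists>c. \<forall>e\<in>nsets A 2. \<chi> e = c"
    proof (cases "clique A {e. \<chi> e = Red}")
      case True
      then have "\<chi> e = Red" if "e \<in> nsets A 2" for e
        using that by (elim nsets2_E) (simp add: clique_def)
      then show ?thesis by blast
    next
      case False
      then have "\<chi> e = Blue" if "e \<in> nsets A 2" for e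
        using that A(3) by (cases "\<chi> e") (auto simp: indep_def elim!: nsets2_E)
      then show ?thesis by blast
    qed
    then show "\<exists>A\<subseteq>V. \<exists>c. card A = t \<and> (\<forall>e\<in>nsets A 2. \<chi> e = c)"
      using A by blast
  qed
qed

text \<open>\<open>P\<close> is built greedily: by double counting, some new vertex lies in
  \<open>N v\<close> for at least a fraction \<open>\<delta> / 2\<close> of the remaining
  \<open>v\<close>.\<close>

lemma ex_common_neighbours:
  fixes N :: "'a \<Rightarrow> 'b set" and \<delta> :: real
  assumes U: "finite U" and V: "finite V" and \<delta>: "0 < \<delta>" "\<delta> \<le> 1"
    and N: "\<And>v. v \<in> U \<Longrightarrow> N v \<subseteq> V" "\<And>v. v \<in> U \<Longrightarrow> \<delta> * card V \<le> card (N v)"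
    and s: "real s \<le> \<delta> / 2 * card V"
  shows "\<exists>P\<subseteq>V. card P = s \<and> (\<delta> / 2) ^ s * card U \<le> card {v \<in> U. P \<subseteq> N v}"
  using s
proof (induction s)
  case 0
  show ?case by (intro exI[of _ "{}"]) auto
next
  case (Suc s)
  then obtain P where P: "P \<subseteq> V" "card P = s"
    "(\<delta> / 2) ^ s * card U \<le> card {v \<in> U. P \<subseteq> N v}" by auto
  define U' where "U' = {v \<in> U. P \<subseteq> N v}"
  have fin: "finite U'" "finite P" using U V P(1) finite_subset by (auto simp: U'_def)
  have "\<delta> / 2 * card V \<le> 1 * real (card V)" using \<delta> by (intro mult_right_mono) auto
  then have "s < card V" using Suc.prems by simp
  \<comment> \<open>Needed for the strict inequality between sums over \<open>V - P\<close>
    below.\<close>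
  then have ne: "V - P \<noteq> {}" using P fin by (metis Diff_eq_empty_iff card_mono leD)
  have "\<exists>x\<in>V - P. \<delta> / 2 * card U' \<le> card {v \<in> U'. x \<in> N v}"
  proof (rule ccontr)
    assume "\<not> ?thesis"
    then have lt: "real (card {v \<in> U'. x \<in> N v}) < \<delta> / 2 * card U'" if "x \<in> V - P" for x
      using that by force
    \<comment> \<open>Count the pairs \<open>(v, x)\<close> with \<open>x \<in> N v - P\<close> in
      two ways. As \<open>s\<close> is below \<open>\<delta> / 2 * card V\<close>, removing
      \<open>P\<close> costs \<open>N v\<close> at most half of its guaranteed size.\<close>
    have "real (card U') * (\<delta> / 2 * card V) = (\<Sum>v\<in>U'. \<delta> / 2 * card V)" by simp
    also have "\<dots> \<le> (\<Sum>v\<in>U'. real (card {x \<in> V - P. x \<in> N v}))"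
    proof (rule sum_mono)
      fix v assume v: "v \<in> U'"
      then have v': "v \<in> U" "P \<subseteq> N v" by (auto simp: U'_def)
      have "{x \<in> V - P. x \<in> N v} = N v - P" using N(1)[OF v'(1)] by blast
      then have "card {x \<in> V - P. x \<in> N v} = card (N v) - s"
        using v' fin P by (simp add: card_Diff_subset)
      then show "\<delta> / 2 * card V \<le> card {x \<in> V - P. x \<in> N v}"
        using N(2)[OF v'(1)] Suc.prems by simp
    qed
    also have "\<dots> = (\<Sum>x\<in>V - P. real (card {v \<in> U'. x \<in> N v}))"
      using sum_multicount_gen[of U' "V - P" "\<lambda>v x. x \<in> N v" "\<lambda>x. card {v \<in> U'. x \<in> N v}"] fin V
      by (simp flip: of_nat_sum)
    also have "\<dots> < (\<Sum>x\<in>V - P. \<delta> / 2 * card U')"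
      by (rule sum_strict_mono) (use V ne lt in auto)
    also have "\<dots> = real (card (V - P)) * (\<delta> / 2 * card U')" by simp
    also have "\<dots> \<le> real (card V) * (\<delta> / 2 * card U')"
      using \<delta> V by (intro mult_right_mono) (auto intro: card_mono)
    finally show False by (simp add: algebra_simps)
  qed
  then obtain x where x: "x \<in> V - P" "\<delta> / 2 * card U' \<le> card {v \<in> U'. x \<in> N v}" by blast
  have "(\<delta> / 2) ^ Suc s * card U \<le> \<delta> / 2 * card U'"
    using P(3) \<delta> unfolding U'_def by (simp add: mult.assoc)
  also note x(2)
  also have "{v \<in> U'. x \<in> N v} = {v \<in> U. insert x P \<subseteq> N v}" by (auto simp: U'_def)
  finally show ?case using x P fin by (intro exI[of _ "insert x P"]) auto
qed

section \<open>Vertices of large degree in both colours\<close>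

text \<open>The colour map is total and colours singletons too; \<open>u \<noteq> v\<close> excludes
  them.\<close>

definition nbrs :: "('a set \<Rightarrow> colour) \<Rightarrow> 'a set \<Rightarrow> colour \<Rightarrow> 'a \<Rightarrow> 'a set" where
  "nbrs \<chi> V c v = {u \<in> V. u \<noteq> v \<and> \<chi> {v, u} = c}"

lemma sum_card_nbrs:
  assumes "finite V"
  shows "(\<Sum>v\<in>V. card (nbrs \<chi> V c v)) = 2 * card {e \<in> nsets V 2. \<chi> e = c}"
proof -
  let ?F = "{e \<in> nsets V 2. \<chi> e = c}"
  have "card (nbrs \<chi> V c v) = card (incident ?F V v)" if "v \<in> V" for v
  proof (rule bij_betw_same_card)
    show "bij_betw (\<lambda>u. {v, u}) (nbrs \<chi> V c v) (incident ?F V v)"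
      unfolding bij_betw_def
    proof (intro conjI equalityI subsetI)
      show "inj_on (\<lambda>u. {v, u}) (nbrs \<chi> V c v)"
        by (auto simp: inj_on_def doubleton_eq_iff)
    next
      fix e assume "e \<in> incident ?F V v"
      then show "e \<in> (\<lambda>u. {v, u}) ` nbrs \<chi> V c v"
        by (auto simp: incident_def inside_def nbrs_def insert_commute elim!: nsets2_E)
    qed (use that in \<open>auto simp: incident_def inside_def nbrs_def\<close>)
  qed
  moreover have "inside ?F V = ?F" by (auto simp: inside_def nsets_def)
  ultimately show ?thesis
    using handshake[of V ?F] assms by (auto simp: nsets_def)
qed

text \<open>If few vertices have large degree in both colours, then almost all vertices are nearly
  monochromatic, and those of the two kinds cannot coexist in large numbers because of the edges
  between them.\<close>

lemma many_vertices_large_degrees: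
  fixes \<chi> :: "'a set \<Rightarrow> colour"
  assumes V: "finite V" "card V = n" "n \<ge> 2" and \<epsilon>: "0 < \<epsilon>" "\<epsilon> \<le> 1 / 2"
    and bal: "\<And>c. \<epsilon> * (real n * (real n - 1)) \<le> (\<Sum>v\<in>V. card (nbrs \<chi> V c v))"
  shows "\<epsilon> / 13 * n \<le> card {v \<in> V. \<forall>c. \<epsilon> / 13 * n \<le> card (nbrs \<chi> V c v)}"
proof (rule ccontr)
  \<comment> \<open>The final count yields at most \<open>6 * \<delta> * n^2\<close>, while balance
    and \<open>n - 1 \<ge> n / 2\<close> demand \<open>\<epsilon> * n^2 / 2\<close>; so
    \<open>\<epsilon> > 12 * \<delta>\<close> suffices.\<close>
  define \<delta> where "\<delta> = \<epsilon> / 13"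
  define U where "U = {v \<in> V. \<forall>c. \<delta> * n \<le> card (nbrs \<chi> V c v)}"
  define L where "L = (\<lambda>c. {v \<in> V. card (nbrs \<chi> V c v) < \<delta> * n})"
  have \<delta>: "0 < \<delta>" "\<delta> \<le> 1 / 26" using \<epsilon> by (auto simp: \<delta>_def)
  have \<delta>n: "\<delta> * n \<le> n / 26"
    using mult_right_mono[OF \<delta>(2), of "real n"] by simp
  assume "\<not> ?thesis"
  then have U: "card U < \<delta> * n" by (simp add: U_def \<delta>_def)
  have fin: "finite U" "finite (L c)" for c using V by (auto simp: U_def L_def)
  \<comment> \<open>A vertex poor in both colours would have total degree below
    \<open>n / 13\<close>, but it has degree \<open>n - 1\<close>.\<close>
  have disj: "L Red \<inter> L Blue = {}"
  proof (rule ccontr)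
    assume "L Red \<inter> L Blue \<noteq> {}"
    then obtain v where v: "v \<in> V" "card (nbrs \<chi> V Red v) < \<delta> * n" "card (nbrs \<chi> V Blue v) < \<delta> * n"
      by (auto simp: L_def)
    have "V - {v} \<subseteq> nbrs \<chi> V Red v \<union> nbrs \<chi> V Blue v"
      using colour.exhaust by (auto simp: nbrs_def)
    then have "card (V - {v}) \<le> card (nbrs \<chi> V Red v \<union> nbrs \<chi> V Blue v)"
      using V by (intro card_mono) (auto simp: nbrs_def)
    also have "\<dots> \<le> card (nbrs \<chi> V Red v) + card (nbrs \<chi> V Blue v)" by (rule card_Un_le)
    finally have "real (n - 1) \<le> 2 * (\<delta> * n)" using V v by simp
    also have "\<dots> \<le> n / 13" using \<delta>n by simp
    finally show False using V by simp
  qed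
  have cover: "V \<subseteq> U \<union> L Red \<union> L Blue"
  proof (rule subsetI, rule ccontr)
    fix v assume v: "v \<in> V" "v \<notin> U \<union> L Red \<union> L Blue"
    then have "\<delta> * n \<le> card (nbrs \<chi> V c v)" for c
      by (cases c) (auto simp: L_def not_less)
    then show False using v by (simp add: U_def)
  qed
  \<comment> \<open>Let \<open>L c\<close> be the larger set. Few edges can run between the two
    sets, so \<open>L c'\<close> is small; then almost all vertices are poor in \<open>c\<close>,
    contradicting balance.\<close>
  have no: False if cc: "c \<noteq> c'" "card (L c') \<le> card (L c)" for c c'
  proof -
    have c: "{c, c'} = {Red, Blue}" using cc(1) by (cases c; cases c') auto
    define a b where "a = real (card (L c))" and "b = real (card (L c'))"
    have ab: "0 \<le> b" "b \<le> a" using cc by (auto simp: a_def b_def)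
    have disj': "L c \<inter> L c' = {}" using disj cc(1) by (cases c; cases c') (simp_all add: Int_commute)
    have cover': "V \<subseteq> U \<union> (L c \<union> L c')"
      using cover cc(1) by (cases c; cases c') (simp_all add: Un_ac)
    have abn: "a + b \<le> n"
    proof -
      have "card (L c \<union> L c') \<le> card V" by (rule card_mono) (use V in \<open>auto simp: L_def\<close>)
      then show ?thesis using disj' fin V by (simp add: card_Un_disjoint a_def b_def)
    qed
    have "card V \<le> card U + card (L c \<union> L c')"
      using card_mono[OF _ cover'] card_Un_le[of U "L c \<union> L c'"] fin by fastforce
    then have nab: "n \<le> \<delta> * n + (a + b)"
      using U V disj' fin by (simp add: card_Un_disjoint a_def b_def)
    \<comment> \<open>A pair of colour \<open>c\<close> is charged to its end in \<open>L c\<close>,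
      a pair of colour \<open>c'\<close> to its end in \<open>L c'\<close>; both ends are poor in
      the colour charged.\<close>
    have edges: "L c \<times> L c' \<subseteq> Sigma (L c) (nbrs \<chi> V c) \<union> prod.swap ` Sigma (L c') (nbrs \<chi> V c')"
    proof (rule subrelI)
      fix x y assume "(x, y) \<in> L c \<times> L c'"
      then have xy: "x \<in> L c" "y \<in> L c'" "x \<noteq> y" "x \<in> V" "y \<in> V"
        using disj' by (auto simp: L_def)
      have "\<chi> {x, y} = c \<or> \<chi> {x, y} = c'" using c by (cases "\<chi> {x, y}") auto
      then have "y \<in> nbrs \<chi> V c x \<or> x \<in> nbrs \<chi> V c' y"
        using xy by (auto simp: nbrs_def insert_commute)
      then show "(x, y) \<in> Sigma (L c) (nbrs \<chi> V c) \<union> prod.swap ` Sigma (L c') (nbrs \<chi> V c')"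
        using xy by force
    qed
    have finN: "finite (nbrs \<chi> V d v)" for d v using V by (auto simp: nbrs_def)
    have sum_L: "(\<Sum>v\<in>L d. real (card (nbrs \<chi> V d v))) \<le> real (card (L d)) * (\<delta> * n)" for d
      using sum_bounded_above[of "L d" "\<lambda>v. real (card (nbrs \<chi> V d v))" "\<delta> * n"]
      by (auto simp: L_def less_imp_le)
    have "card (L c \<times> L c') \<le> card (Sigma (L c) (nbrs \<chi> V c) \<union> prod.swap ` Sigma (L c') (nbrs \<chi> V c'))"
      by (rule card_mono[OF _ edges]) (use fin finN in auto)
    also have "\<dots> \<le> card (Sigma (L c) (nbrs \<chi> V c)) + card (Sigma (L c') (nbrs \<chi> V c'))"
      by (rule order_trans[OF card_Un_le]) (intro add_left_mono card_image_le, use fin finN in auto)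
    finally have "a * b \<le> (\<Sum>v\<in>L c. real (card (nbrs \<chi> V c v))) + (\<Sum>v\<in>L c'. real (card (nbrs \<chi> V c' v)))"
      using fin finN by (simp add: card_cartesian_product card_SigmaI a_def b_def
          flip: of_nat_mult of_nat_add of_nat_sum)
    also have "\<dots> \<le> (a + b) * (\<delta> * n)"
      using sum_L[of c] sum_L[of c'] by (simp add: a_def b_def algebra_simps)
    also have "\<dots> \<le> n * (\<delta> * n)" using abn \<delta> by (intro mult_right_mono) auto
    finally have prod: "a * b \<le> n * (\<delta> * n)" .
    \<comment> \<open>The sets cover all but \<open>n / 26\<close> vertices and \<open>L c\<close>
      is the larger one.\<close>
    have a: "n / 4 \<le> a" using \<delta>n nab ab by simp
    have "real n / 4 * b \<le> a * b" using a ab by (intro mult_right_mono) auto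
    then have "real n * b \<le> real n * (4 * \<delta> * n)" using prod by simp
    then have b: "b \<le> 4 * \<delta> * n" using V by simp
    have nb: "real (card (nbrs \<chi> V c v)) \<le> n" for v
      using V by (auto simp: nbrs_def intro!: card_mono)
    have "(\<Sum>v\<in>V. real (card (nbrs \<chi> V c v))) \<le> (\<Sum>v\<in>U \<union> (L c \<union> L c'). real (card (nbrs \<chi> V c v)))"
      by (intro sum_mono2 cover') (use fin in auto)
    also have "\<dots> \<le> (\<Sum>v\<in>U. real (card (nbrs \<chi> V c v)))
        + ((\<Sum>v\<in>L c. real (card (nbrs \<chi> V c v))) + (\<Sum>v\<in>L c'. real (card (nbrs \<chi> V c v))))"
    proof -
      have le: "sum f (A \<union> B) \<le> sum f A + sum f B" if "finite A" "finite B" "\<And>x. f x \<ge> 0"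
        for f :: "'a \<Rightarrow> real" and A B
        using sum.union_inter[OF that(1,2), of f] sum_nonneg[of "A \<inter> B" f] that(3) by simp
      let ?f = "\<lambda>v. real (card (nbrs \<chi> V c v))"
      have "sum ?f (U \<union> (L c \<union> L c')) \<le> sum ?f U + sum ?f (L c \<union> L c')"
        by (rule le) (use fin in auto)
      also have "sum ?f (L c \<union> L c') \<le> sum ?f (L c) + sum ?f (L c')"
        by (rule le) (use fin in auto)
      finally show ?thesis by simp
    qed
    \<comment> \<open>Only vertices of \<open>L c\<close> have small degree in \<open>c\<close>; the
      others lie in the small sets \<open>U\<close> and \<open>L c'\<close> and are counted with
      degree \<open>n\<close>.\<close>
    also have "\<dots> \<le> card U * real n + (a * (\<delta> * n) + b * n)"
      using sum_bounded_above[of U "\<lambda>v. real (card (nbrs \<chi> V c v))" n]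
        sum_bounded_above[of "L c'" "\<lambda>v. real (card (nbrs \<chi> V c v))" n] sum_L[of c] nb
      unfolding a_def b_def by (intro add_mono) auto
    also have "\<dots> \<le> (\<delta> * n) * n + (n * (\<delta> * n) + (4 * \<delta> * n) * n)"
      using U b abn ab \<delta> by (intro add_mono mult_right_mono) auto
    also have "\<dots> = 6 * \<delta> * n * n" by simp
    also have "\<dots> < 13 * \<delta> * (n * (n / 2))"
      using \<delta> V by simp
    also have "\<dots> \<le> \<epsilon> * (real n * (real n - 1))"
      unfolding \<delta>_def using \<epsilon> V by (simp add: mult_left_mono)
    finally show False using bal[of c] by simp
  qed
  show False using no[of Red Blue] no[of Blue Red] by (meson colour.distinct nat_le_linear)
qed

text \<open>Shows that the \<open>LEAST\<close> in \<open>R\<close> is attained. The colour of the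
  clique in \<open>T\<close> is not known beforehand, so \<open>T\<close> must be joined in red to
  one set and in blue to another.\<close>

lemma complete_contains_unavoidable:
  assumes \<epsilon>: "0 < \<epsilon>" "\<epsilon> \<le> 1 / 2"
  shows "\<exists>r. \<forall>n\<ge>r. \<forall>G :: 'a bigraph. bicolored_complete n G \<and> balanced \<epsilon> G \<longrightarrow>
    contains_unavoidable t G"
proof -
  from ex_monochromatic_subset obtain s where "\<forall>V \<chi>. finite (V :: 'a set) \<and> s \<le> card V \<longrightarrow>
    (\<exists>A\<subseteq>V. \<exists>c :: colour. card A = t \<and> (\<forall>e\<in>nsets A 2. \<chi> e = c))" ..
  note s = this[rule_format, OF conjI]
  define \<delta> where "\<delta> = \<epsilon> / 13"
  have \<delta>: "0 < \<delta>" "\<delta> \<le> 1" using \<epsilon> by (auto simp: \<delta>_def)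
  \<comment> \<open>One factor for each of the two applications of
    \<open>ex_common_neighbours\<close>.\<close>
  define p where "p = (\<delta> / 2) ^ s * (\<delta> / 2) ^ s"
  have p: "0 < p" "p \<le> 1" using \<delta> by (auto simp: p_def intro!: mult_le_one power_le_one)
  \<comment> \<open>This gives \<open>s \<le> p * \<delta> / 2 * n\<close>, enough both to choose
    \<open>P\<close> and \<open>Q\<close> and to make \<open>T\<close> large.\<close>
  obtain r :: nat where r: "s / (p * (\<delta> / 2)) \<le> r" using real_arch_simple by blast
  have "contains_unavoidable t G"
    if n: "n \<ge> max 2 r" and G: "bicolored_complete n G" "balanced \<epsilon> G" for n and G :: "'a bigraph"
  proof -
    define V \<chi> where "V = verts G" and "\<chi> = colour_of G"
    define N where "N = nbrs \<chi> V"
    have V: "finite V" "card V = n" "edges G = nsets V 2"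
      using G by (auto simp: V_def bicolored_complete_def bicolored_graph_def)
    have "s / (p * (\<delta> / 2)) \<le> n" using r n by linarith
    then have sn: "s \<le> p * (\<delta> / 2 * n)" using p \<delta> by (simp add: field_simps)
    also have "\<dots> \<le> 1 * (\<delta> / 2 * n)" using p \<delta> by (intro mult_right_mono) auto
    finally have sn': "s \<le> \<delta> / 2 * card V" using V by simp
    have "card (nsets V 2) = n choose 2" using V by simp
    then have e: "real (card (edges G)) = real n * (real n - 1) / 2"
      using real_choose_two V(3) by metis
    have "\<epsilon> * (real n * (real n - 1)) \<le> (\<Sum>v\<in>V. card (nbrs \<chi> V c v))" for c
    proof -
      have "\<epsilon> * card (edges G) \<le> card (colour_class G c)"
        using G(2) by (simp add: balanced_def)
      also have "colour_class G c = {e \<in> nsets V 2. \<chi> e = c}"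
        by (simp add: colour_class_def V(3) \<chi>_def)
      finally show ?thesis
        unfolding sum_card_nbrs[OF V(1)] e by simp
    qed
    from many_vertices_large_degrees[OF V(1,2) _ \<epsilon> this] n
    have U: "\<delta> * n \<le> card {v \<in> V. \<forall>c. \<delta> * n \<le> card (N c v)}"
      by (simp add: \<delta>_def N_def)
    define U where "U = {v \<in> V. \<forall>c. \<delta> * n \<le> card (N c v)}"
    have U': "finite U" using V by (simp add: U_def)
    have deg: "\<delta> * card V \<le> card (N c v)" if "v \<in> U" for c v
      using that V by (simp add: U_def)
    have NV: "N c v \<subseteq> V" for c v by (auto simp: N_def nbrs_def)
    obtain P where P: "P \<subseteq> V" "card P = s"
      "(\<delta> / 2) ^ s * card U \<le> card {v \<in> U. P \<subseteq> N Red v}"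
      using ex_common_neighbours[where N = "N Red", OF U' V(1) \<delta> NV deg sn'] by blast
    define W where "W = {v \<in> U. P \<subseteq> N Red v}"
    have W': "finite W" and W_sub: "v \<in> W \<Longrightarrow> v \<in> U" for v using U' by (auto simp: W_def)
    obtain Q where Q: "Q \<subseteq> V" "card Q = s"
      "(\<delta> / 2) ^ s * card W \<le> card {v \<in> W. Q \<subseteq> N Blue v}"
      using ex_common_neighbours[where N = "N Blue", OF W' V(1) \<delta> NV deg[OF W_sub] sn'] by blast
    define T where "T = {v \<in> W. Q \<subseteq> N Blue v}"
    have "s \<le> p * (\<delta> * n)" using sn p \<delta> by simp
    also have "\<dots> \<le> p * card U" using U p by (intro mult_left_mono) (auto simp: U_def)
    also have "\<dots> = (\<delta> / 2) ^ s * ((\<delta> / 2) ^ s * card U)" by (simp add: p_def)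
    also have "\<dots> \<le> (\<delta> / 2) ^ s * card W" using P(3) \<delta> by (intro mult_left_mono) (auto simp: W_def)
    also have "\<dots> \<le> card T" using Q(3) by (simp add: T_def)
    finally have sT: "s \<le> card T" by simp
    have T: "finite T" "T \<subseteq> V" using V by (auto simp: T_def W_def U_def)
    obtain A c where A: "A \<subseteq> T" "card A = t" "\<And>e. e \<in> nsets A 2 \<Longrightarrow> \<chi> e = c"
      using s[OF T(1) sT, of \<chi>] by blast
    \<comment> \<open>\<open>Z\<close> is \<open>P\<close> or \<open>Q\<close>, whichever is joined
      to \<open>T\<close> in the colour other than \<open>c\<close>.\<close>
    obtain Z c' where Z: "Z \<subseteq> V" "card Z = s" "c \<noteq> c'" "\<And>v. v \<in> T \<Longrightarrow> Z \<subseteq> N c' v"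
    proof (cases c)
      case Red
      then show ?thesis using that[of Q Blue] Q by (auto simp: T_def)
    next
      case Blue
      then show ?thesis using that[of P Red] P by (auto simp: T_def W_def)
    qed
    obtain B d where B: "B \<subseteq> Z" "card B = t" "\<And>e. e \<in> nsets B 2 \<Longrightarrow> \<chi> e = d"
      using s[of Z \<chi>] Z V finite_subset by (metis order_refl)
    have cross: "a \<noteq> b \<and> \<chi> {a, b} = c'" if "a \<in> A" "b \<in> B" for a b
      using that A(1) B(1) Z(4) by (fastforce simp: N_def nbrs_def)
    show ?thesis
    proof (rule contains_unavoidableI[of A B t G c d c'])
      have AB: "A \<union> B \<subseteq> V" using A B Z T by blast
      then show "finite A" "finite B" using V finite_subset by auto
      show "A \<inter> B = {}" using cross by blast
      show "A \<union> B \<subseteq> verts G" using AB by (simp add: V_def)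
      show "nsets (A \<union> B) 2 \<subseteq> edges G" using AB V(3) nsets_mono by blast
    qed (use A B Z cross in \<open>auto simp: \<chi>_def\<close>)
  qed
  then show ?thesis by blast
qed

section \<open>Dense graphs\<close>

text \<open>The existence of a valid bound gives \<open>R\<close> its defining property through
  \<open>LeastI_ex\<close>; the clique on \<open>T\<close> is then copied to the natural
  numbers.\<close>

lemma contains_unavoidable_if_R_le:
  fixes G :: "'a bigraph"
  assumes \<epsilon>: "0 < \<epsilon>" "\<epsilon> \<le> 1 / 2" and G: "bicolored_graph G"
    and T: "finite T" "T \<subseteq> verts G" "nsets T 2 \<subseteq> edges G"
    and card: "R \<epsilon> t \<le> card T"
    and bal: "\<And>c. \<epsilon> * (card T choose 2) \<le> card (inside (colour_class G c) T)"
  shows "contains_unavoidable t G"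
proof -
  have R: "\<forall>n\<ge>R \<epsilon> t. \<forall>G :: nat bigraph. bicolored_complete n G \<and> balanced \<epsilon> G \<longrightarrow>
    contains_unavoidable t G"
    unfolding R_def using complete_contains_unavoidable[OF \<epsilon>, where 'a = nat and t = t]
    by (rule LeastI_ex)
  obtain f where f: "bij_betw f {..<card T} T"
    using ex_bij_betw_nat_finite[OF T(1)] by (auto simp: atLeast0LessThan)
  define V and H where "V = {..<card T}" and "H = pullback f V G"
  have inj: "inj_on f V" and im: "f ` V = T" using f by (auto simp: V_def bij_betw_def)
  have compl: "bicolored_complete (card T) H"
    using bicolored_complete_pullback[of V f G] by (simp add: H_def V_def)
  have "card (inside (colour_class G c) T) \<le> card (colour_class H c)" for c
  proof (rule card_inj_on_le[of "\<lambda>e. (inv_into V f) ` e"])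
    have e: "e \<in> nsets T 2" "colour_of G e = c" if "e \<in> inside (colour_class G c) T" for e
      using that G by (auto simp: inside_def colour_class_def bicolored_graph_def nsets_def)
    have inv: "f ` inv_into V f ` e = e" if "e \<in> nsets T 2" for e
      using that im by (simp add: nsets_def image_inv_into_cancel)
    have inv': "inv_into V f ` e \<in> nsets V 2" if "e \<in> nsets T 2" for e
      using image_nsets_2[of "inv_into V f" T e] inj im that
      by (metis inj_on_inv_into inv_into_image_cancel order_refl)
    show "inj_on (\<lambda>e. inv_into V f ` e) (inside (colour_class G c) T)"
      using e(1) inv by (metis inj_onI)
    show "(\<lambda>e. inv_into V f ` e) ` inside (colour_class G c) T \<subseteq> colour_class H c"
      using e inv inv' by (auto simp: colour_class_def H_def pullback_def)
    show "finite (colour_class H c)"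
      using finite_imp_finite_nsets[of V 2] by (simp add: colour_class_def H_def pullback_def V_def)
  qed
  moreover have "card (edges H) = card T choose 2"
    by (simp add: H_def pullback_def V_def)
  ultimately have "balanced \<epsilon> H"
    unfolding balanced_def using bal by (metis of_nat_le_iff order_trans)
  then have "contains_unavoidable t H" using R card compl by blast
  moreover have "contained_in H G"
    unfolding H_def using inj im T by (intro contained_in_pullback) auto
  ultimately show ?thesis by (rule contains_unavoidable_trans)
qed

theorem theorem1p1:
  fixes \<epsilon> \<epsilon>' :: real
  assumes "0 < \<epsilon>" and "\<epsilon> \<le> 1 / 2" and "0 < \<epsilon>'" and "\<epsilon>' < \<epsilon>"
  shows "\<exists>K::real. K > 0 \<and> (\<forall>t::nat. t \<ge> 1 \<longrightarrow>
           (\<exists>n0::nat. \<forall>G :: 'a bigraph.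
              bicolored_graph G \<and> balanced \<epsilon> G \<and> card (verts G) \<ge> n0 \<and>
              real (card (edges G)) \<ge>
                (1 - 1 / (K * real (R \<epsilon>' t))) * real (card (verts G) choose 2)
              \<longrightarrow> contains_unavoidable t G))"
proof -
  \<comment> \<open>The losses in density are \<open>\<delta>\<close> for missing pairs,
    \<open>\<delta>\<close> for passing to \<open>S\<close> and \<open>2 * \<delta>\<close> for the
    final deletions, within the available \<open>8 * \<delta>\<close>.\<close>
  define \<delta> where "\<delta> = (\<epsilon> - \<epsilon>') / 8"
  have \<delta>: "0 < \<delta>" "\<delta> \<le> 1 / 16" using assms by (auto simp: \<delta>_def)
  \<comment> \<open>Makes the final potential \<open>24 / m\<close> at most
    \<open>\<delta>^2\<close>.\<close>
  obtain C :: nat where C0: "24 / \<delta>\<^sup>2 \<le> C" using real_arch_simple by blast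
  have "\<delta>\<^sup>2 \<le> 1" using \<delta> by (intro power_le_one) auto
  then have "24 \<le> 24 / \<delta>\<^sup>2" using \<delta> by (simp add: field_simps)
  then have C: "24 \<le> C" using C0 by linarith
  \<comment> \<open>Chosen so that \<open>1 / (K * r) = \<delta> / m\<close>.\<close>
  define K where "K = C / \<delta>"
  have K: "K > 0" using C \<delta> by (simp add: K_def)
  have "contains_unavoidable t G"
    if G: "bicolored_graph G" "balanced \<epsilon> G"
      and large: "card (verts G) \<ge> C * max 1 (R \<epsilon>' t)"
      and dense: "real (card (edges G)) \<ge> (1 - 1 / (K * real (R \<epsilon>' t))) * real (card (verts G) choose 2)"
    for t and G :: "'a bigraph"
  proof -
    \<comment> \<open>The maximum ensures \<open>m \<ge> C\<close> whatever the value of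
      \<open>R\<close>.\<close>
    define r where "r = max 1 (R \<epsilon>' t)"
    define m where "m = C * r"
    define V where "V = verts G"
    define M where "M = nsets V 2 - edges G"
    define F where "F = colour_class G"
    have r: "1 \<le> r" "R \<epsilon>' t \<le> r" by (auto simp: r_def)
    have Cm: "C \<le> m" using r by (simp add: m_def)
    have m: "24 \<le> m" "m \<le> card V" using C Cm large by (linarith, simp add: m_def r_def V_def)
    have V: "finite V" "edges G \<subseteq> nsets V 2"
      using G by (auto simp: bicolored_graph_def V_def)
    have F2: "\<forall>e\<in>F c. card e = 2" and M2: "\<forall>e\<in>M. card e = 2" for c
      using V by (auto simp: F_def colour_class_def M_def nsets_def)
    have Km: "1 / (K * r) = \<delta> / m" by (simp add: K_def m_def)
    have "real (card V) * (real (card V) - 1) > 0" using m by auto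
    then have pos: "real (card V choose 2) > 0" by (simp add: real_choose_two)
    have "1 / (K * real (R \<epsilon>' t)) \<le> \<delta> / m"
    \<comment> \<open>If \<open>R\<close> is 0, the quotient is 0 by the convention for
      division.\<close>
    proof (cases "R \<epsilon>' t = 0")
      case True
      then show ?thesis using \<delta> by simp
    next
      case False
      then show ?thesis using Km by (simp add: r_def max_def split: if_splits)
    qed
    then have "(1 - \<delta> / m) * (card V choose 2)
        \<le> (1 - 1 / (K * real (R \<epsilon>' t))) * real (card (verts G) choose 2)"
      unfolding V_def by (intro mult_right_mono) auto
    then have dense': "(1 - \<delta> / m) * (card V choose 2) \<le> card (edges G)"
      using dense by linarith
    have insideV: "inside (F c) V = F c" "inside M V = M" for c
      using V by (auto simp: inside_def F_def colour_class_def M_def nsets_def)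
    have "finite (nsets V 2)" using V finite_imp_finite_nsets by blast
    then have "card M = (card V choose 2) - card (edges G)" "card (edges G) \<le> card V choose 2"
      unfolding M_def using V card_mono[of "nsets V 2" "edges G"]
      by (auto simp: card_Diff_subset finite_subset)
    then have "real (card M) \<le> \<delta> / m * (card V choose 2)"
      using dense' by (simp add: of_nat_diff algebra_simps)
    then have densM: "density M V \<le> \<delta> / m"
      using pos by (simp add: density_def insideV divide_le_eq)
    have "\<delta> / m \<le> \<delta> / 1" using \<delta> m by (intro divide_left_mono) auto
    then have \<delta>m: "\<delta> / m \<le> \<delta>" by simp
    \<comment> \<open>Balance is relative to the edges present, density to all pairs; the missing
      pairs account for the loss.\<close>
    have densF: "\<epsilon> - \<delta> \<le> density (F c) V" for c
    proof -
      have "\<epsilon> * (\<delta> / m) \<le> 1 * \<delta>" using \<delta>m \<delta> assms by (intro mult_mono) auto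
      then have "(\<epsilon> - \<delta>) * (card V choose 2) \<le> \<epsilon> * (1 - \<delta> / m) * (card V choose 2)"
        by (intro mult_right_mono) (auto simp: algebra_simps)
      also have "\<dots> \<le> \<epsilon> * card (edges G)"
        using mult_left_mono[OF dense', of \<epsilon>] assms by (simp add: mult.assoc)
      also have "\<dots> \<le> card (F c)" using G(2) by (simp add: balanced_def F_def)
      finally show ?thesis using pos by (simp add: density_def insideV le_divide_eq)
    qed
    \<comment> \<open>With the weight \<open>12 / \<delta>\<close> both the initial potential and its total growth are at most \<open>12 / m\<close>.\<close>
    define dev where
      "dev = deviation {Red, Blue} F (\<lambda>c. density (F c) V) (12 / \<delta>) M"
    \<comment> \<open>The squares vanish at \<open>V\<close>, since the targets are its own
      densities.\<close>
    have "dev V \<le> 12 / m"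
      using mult_left_mono[OF densM, of "12 / \<delta>"] \<delta> by (simp add: dev_def deviation_def)
    have "\<exists>S\<subseteq>V. card S = m \<and> dev S \<le> dev V + 4 * real (card {Red, Blue}) / (real m - 2)"
      unfolding dev_def by (rule ex_subset_deviation_le) (use V m F2 M2 in auto)
    then obtain S where S: "S \<subseteq> V" "card S = m"
      "dev S \<le> dev V + 4 * real (card {Red, Blue}) / (real m - 2)" by blast
    have "8 / (real m - 2) \<le> 12 / m" using m by (simp add: field_simps)
    then have devS: "dev S \<le> 24 / m"
      using S(3) \<open>dev V \<le> 12 / m\<close> by simp
    have parts: "dev S = (density (F Red) S - density (F Red) V)\<^sup>2
        + (density (F Blue) S - density (F Blue) V)\<^sup>2 + 12 / \<delta> * density M S"
      by (simp add: dev_def deviation_def)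
    have densM0: "0 \<le> 12 / \<delta> * density M S" using \<delta> by (simp add: density_def)
    have "24 / m \<le> 24 / C" using C Cm by (intro divide_left_mono) auto
    also have "\<dots> \<le> \<delta>\<^sup>2" using C0 \<delta> C by (simp add: field_simps)
    finally have devS': "dev S \<le> \<delta>\<^sup>2" using devS by simp
    \<comment> \<open>All terms of the potential are nonnegative, so each square is at most
      \<open>\<delta>^2\<close>.\<close>
    have densFS: "\<epsilon> - 2 * \<delta> \<le> density (F c) S" for c
    proof -
      have "(density (F c) S - density (F c) V)\<^sup>2 \<le> \<delta>\<^sup>2"
        using parts densM0 devS' zero_le_power2[of "density (F Red) S - density (F Red) V"]
          zero_le_power2[of "density (F Blue) S - density (F Blue) V"]
        by (cases c; simp only:)
      then have "\<bar>density (F c) S - density (F c) V\<bar> \<le> \<delta>"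
        using \<delta> by (simp add: abs_le_square_iff[symmetric])
      then show ?thesis using densF[of c] by linarith
    qed
    \<comment> \<open>The weight \<open>12 / \<delta>\<close> pays off here: density
      \<open>2 * \<delta> / m\<close> means at most \<open>\<delta> * (m - 1)\<close> missing pairs,
      few enough to delete an end of each.\<close>
    have "12 / \<delta> * density M S \<le> 24 / m" using parts devS by (smt (verit) zero_le_power2)
    then have densMS: "density M S \<le> 2 * \<delta> / m" using \<delta> m by (simp add: field_simps)
    have fS: "finite S" using S(1) V(1) finite_subset by blast
    have choose_m: "real (card S choose 2) = m * (real m - 1) / 2" 
      using S(2) real_choose_two by blast
    have choose_pos: "m * (real m - 1) / 2 > 0" using m by auto
    obtain D where D: "D \<subseteq> S" "card D \<le> card (inside M S)" "inside M (S - D) = {}"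
      using ex_removal_set[OF fS M2] by blast
    have "real (card (inside M S)) \<le> 2 * \<delta> / m * (m * (real m - 1) / 2)"
      using densMS choose_pos unfolding density_def choose_m by (simp add: pos_divide_le_eq)
    also have "\<dots> = \<delta> * (real m - 1)" using m by simp
    also have "\<dots> \<le> \<delta> * m" using \<delta> by simp
    finally have cardD: "real (card D) \<le> \<delta> * m" using D(2) by linarith
    define T where "T = S - D"
    have fD: "finite D" using D(1) fS finite_subset by blast
    have T: "finite T" "T \<subseteq> verts G" using fS S(1) by (auto simp: T_def V_def)
    have cardT: "card T = m - card D" "card D \<le> m"
      using D(1) fS fD S(2) card_mono[OF fS D(1)] by (auto simp: T_def card_Diff_subset)
    \<comment> \<open>At least \<open>15 / 16 * m\<close> vertices survive, which exceeds
      \<open>r\<close>.\<close>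
    have "2 * real r \<le> C * real r" using C by (intro mult_right_mono) auto
    moreover have "\<delta> * m \<le> 1 / 16 * m" using \<delta> by (intro mult_right_mono) auto
    moreover have "real (card T) = real m - card D"
      using cardT by (simp add: of_nat_diff)
    ultimately have "real r \<le> real (card T)"
      using cardD by (simp add: m_def)
    then have RT: "R \<epsilon>' t \<le> card T" using r by linarith
    have clique: "nsets T 2 \<subseteq> edges G"
    proof
      fix e assume e: "e \<in> nsets T 2"
      then have "e \<in> nsets V 2" "e \<subseteq> T" using nsets_mono[of T V 2] T by (auto simp: V_def nsets_def)
      then show "e \<in> edges G" using D(3) by (auto simp: inside_def M_def T_def)
    qed
    \<comment> \<open>The deletions destroy at most \<open>\<delta> * m * (m - 1)\<close> edges of
      each colour, that is \<open>2 * \<delta>\<close> times the number of pairs in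
      \<open>S\<close>, and \<open>T\<close> has no more pairs than \<open>S\<close>.\<close>
    have bal: "\<epsilon>' * (card T choose 2) \<le> card (inside (F c) T)" for c
    proof -
      have "real (card T choose 2) \<le> m * (real m - 1) / 2"
        unfolding choose_m[symmetric]
        using card_mono[OF finite_imp_finite_nsets[OF fS] nsets_mono[of T S 2]] by (simp add: T_def)
      then have "\<epsilon>' * (card T choose 2) \<le> \<epsilon>' * (m * (real m - 1) / 2)"
        using assms by (intro mult_left_mono) auto
      also have "\<dots> \<le> (\<epsilon> - 2 * \<delta> - 2 * \<delta>) * (m * (real m - 1) / 2)"
        using choose_pos \<delta> by (intro mult_right_mono) (auto simp: \<delta>_def field_simps)
      also have "\<dots> = (\<epsilon> - 2 * \<delta>) * (m * (real m - 1) / 2) - \<delta> * m * (real m - 1)"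
        by (simp add: field_simps)
      also have "\<dots> \<le> card (inside (F c) S) - card D * (real m - 1)"
      proof (rule diff_mono)
        show "(\<epsilon> - 2 * \<delta>) * (m * (real m - 1) / 2) \<le> card (inside (F c) S)"
          using densFS[of c] choose_pos unfolding density_def choose_m by (simp add: pos_le_divide_eq)
        show "card D * (real m - 1) \<le> \<delta> * m * (real m - 1)"
          using cardD m by (intro mult_right_mono) auto
      qed
      also have "\<dots> \<le> card (inside (F c) T)"
      proof -
        have "real (card (inside (F c) S)) \<le> card (inside (F c) T) + card D * real (m - 1)"
          using card_inside_Diff_ge[OF fS F2 fD, of c] unfolding S(2) T_def
          by (metis of_nat_add of_nat_le_iff of_nat_mult)
        then show ?thesis using m by (simp add: of_nat_diff)
      qed
      finally show ?thesis .
    qed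
    show ?thesis
      using contains_unavoidable_if_R_le[OF assms(3) _ G(1) T clique RT] bal assms by (simp add: F_def)
  qed
  then show ?thesis using K by blast
qed

end
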